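(* Any solution $(u_h^n,\phi_h^n)$, $n=1,\dots,N$, of the fully discrete scheme (S) described in the context satisfies discrete mass and energy conservation: $$\mathcal M_h^n=\mathcal M_h^0,\qquad \mathcal E_h^n=\mathcal E_h^0,\qquad n=1,2,\dots,N,$$ where the discrete mass and energy are defined by $$\mathcal M_h^n:=\|u_h^n\|_{L^2}^2,\qquad \mathcal E_h^n:=\|\nabla u_h^n\|_{L^2}^2+\frac{\alpha}{2}\|\phi_h^n\|_{L^2}^2+\frac{\beta^2}{2}\|\nabla\phi_h^n\|_{L^2}^2.$$
   Context: Let $\Omega\subset\mathbb{R}^d$ ($d=2,3$) be an open bounded convex polygonal ($d=2$) or polyhedral ($d=3$) domain, $T>0$, and let $\alpha,\beta\ge0$ be real constants. Write $\mathbf i=\sqrt{-1}$. The initial data are $u_0\in H_0^1(\Omega)$ (complex-valued) and $\phi_0\in H_0^1(\Omega)$ (real-valued). The scheme below discretizes the system $\mathbf i u_t+\Delta u-\phi u=0$, $\alpha\phi-\beta^2\Delta\phi=|u|^2$ in $\Omega\times(0,T]$ with $u(\cdot,0)=u_0$, $\phi(\cdot,0)=\phi_0$ and homogeneous Dirichlet boundary conditions. Finite element spaces: $\mathcal T_h$ is a quasi-uniform partition of $\Omega$ into triangles ($d=2$) or tetrahedra ($d=3$) $\mathcal K_j$, with mesh size $h=\max_j \mathrm{diam}\,\mathcal K_j$. For a fixed integer $r\ge1$, $V_h$ is the space of real-valued functions $v_h\in C(\overline\Omega)$ with $v_h=0$ on $\partial\Omega$ whose restriction to each $\mathcal K_j$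 is a polynomial of degree at most $r$, and $\widetilde V_h=V_h\oplus\mathbf i V_h$. The inner product is $(u,v)=\int_\Omega u\,v^*\,d\mathbf x$, where $v^*$ is the complex conjugate of $v$. The Ritz projection $R_h:H_0^1(\Omega)\to V_h$ is defined by $(\nabla(v-R_hv),\nabla w_h)=0$ for all $w_h\in V_h$ (for complex-valued functions, applied to real and imaginary parts, with values in $\widetilde V_h$). Time discretization: $N$ is a positive integer, $\tau=T/N$. For a sequence $\omega^n$, $D_\tau\omega^n=(\omega^n-\omega^{n-1})/\tau$ and $\overline\omega^{\,n-\frac12}=(\omega^n+\omega^{n-1})/2$. Scheme (S): $u_h^0=R_hu_0$, $\phi_h^0=R_h\phi_0$, and for $n=1,\dots,N$, $(u_h^n,\phi_h^n)\in\widetilde V_h\times V_h$ satisfies $$\mathbf i(D_\tau u_h^n,v_h)-(\nabla\overline u_h^{\,n-\frac12},\nabla v_h)-(\overline\phi_h^{\,n-\frac12}\,\overline u_h^{\,n-\frac12},v_h)=0\quad\forall v_h\in\widetilde V_h,$$ $$\alpha(\phi_h^n,w_h)+\beta^2(\nabla\phi_h^n,\nabla w_h)=(|u_h^n|^2,w_h)\quad\forall w_h\in V_h.$$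
   Formalization: Energy equality with level 0 is proved only if the discrete elliptic equation also holds at n=0; otherwise it fails (u_0=0, R_h φ_0≠0, α+β>0). Without this, energy equality with level 1 is proved for n=1,…,N. Mass conservation is as stated. *)

theory Defs
  imports "HOL-Analysis.Analysis"
begin

section \<open>Gradients and the space \<open>H\<^sup>1\<^sub>0(\<Omega>)\<close>\<close>

definition partial :: "'d \<Rightarrow> (real^'d \<Rightarrow> 'a::real_normed_vector) \<Rightarrow> real^'d \<Rightarrow> 'a" where
  "partial i f x = frechet_derivative f (at x) (axis i 1)"

text \<open>
  The pointwise gradient.  It is applied only to smooth functions and to finite element
  functions.  The latter are differentiable off the cell boundaries, which form a null set, and
  there the pointwise gradient agrees with the weak one.
\<close>

definition grad :: "(real^'d \<Rightarrow> 'a::real_normed_vector) \<Rightarrow> real^'d \<Rightarrow> 'a^'d" where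
  "grad f x = (\<chi> i. partial i f x)"

definition L2_on :: "(real^'d) set \<Rightarrow> (real^'d \<Rightarrow> 'a::euclidean_space) set" where
  "L2_on \<Omega> = {f. set_borel_measurable lebesgue \<Omega> f \<and>
                 set_integrable lebesgue \<Omega> (\<lambda>x. (norm (f x))\<^sup>2)}"

definition L2_norm :: "(real^'d) set \<Rightarrow> (real^'d \<Rightarrow> 'a::euclidean_space) \<Rightarrow> real" where
  "L2_norm \<Omega> f = sqrt (LINT x:\<Omega>|lebesgue. (norm (f x))\<^sup>2)"

text \<open>
  \<open>C\<^sub>c\<^sup>\<infinity>(\<Omega>)\<close>.  If all iterated partial derivatives exist and are Frechet differentiable
  everywhere, then they are all continuous.
\<close>

definition test_functions :: "(real^'d) set \<Rightarrow> (real^'d \<Rightarrow> real) set" where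
  "test_functions \<Omega> =
     {\<psi>. (\<forall>is x. foldr partial is \<psi> differentiable (at x)) \<and>
          compact (closure {x. \<psi> x \<noteq> 0}) \<and> closure {x. \<psi> x \<noteq> 0} \<subseteq> \<Omega>}"

text \<open>\<open>v \<in> H\<^sup>1(\<Omega>)\<close> with weak gradient \<open>g\<close>.\<close>

definition has_weak_gradient ::
    "(real^'d) set \<Rightarrow> (real^'d \<Rightarrow> real) \<Rightarrow> (real^'d \<Rightarrow> real^'d) \<Rightarrow> bool" where
  "has_weak_gradient \<Omega> v g \<longleftrightarrow> v \<in> L2_on \<Omega> \<and> g \<in> L2_on \<Omega> \<and>
     (\<forall>\<psi>\<in>test_functions \<Omega>. \<forall>i.
        (LINT x:\<Omega>|lebesgue. v x * partial i \<psi> x) = - (LINT x:\<Omega>|lebesgue. g x $ i * \<psi> x))"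

text \<open>The closure of \<open>C\<^sub>c\<^sup>\<infinity>(\<Omega>)\<close> in \<open>H\<^sup>1(\<Omega>)\<close>.\<close>

definition H10 :: "(real^'d) set \<Rightarrow> (real^'d \<Rightarrow> real) set" where
  "H10 \<Omega> = {v. \<exists>g. has_weak_gradient \<Omega> v g \<and>
     (\<exists>\<psi>. (\<forall>k::nat. \<psi> k \<in> test_functions \<Omega>) \<and>
        (\<lambda>k. L2_norm \<Omega> (\<lambda>x. \<psi> k x - v x)) \<longlonglongrightarrow> 0 \<and>
        (\<lambda>k. L2_norm \<Omega> (\<lambda>x. grad (\<psi> k) x - g x)) \<longlonglongrightarrow> 0)}"

definition H10c :: "(real^'d) set \<Rightarrow> (real^'d \<Rightarrow> complex) set" where
  "H10c \<Omega> = {v. (\<lambda>x. Re (v x)) \<in> H10 \<Omega> \<and> (\<lambda>x. Im (v x)) \<in> H10 \<Omega>}"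

section \<open>Inner products on \<open>L\<^sup>2(\<Omega>)\<close>\<close>

text \<open>For real-valued functions and real vector fields.\<close>

definition rprod :: "(real^'d) set \<Rightarrow> (real^'d \<Rightarrow> 'a::real_inner) \<Rightarrow> (real^'d \<Rightarrow> 'a) \<Rightarrow> real" where
  "rprod \<Omega> u v = (LINT x:\<Omega>|lebesgue. u x \<bullet> v x)"

text \<open>For complex-valued functions and complex vector fields; conjugate-linear in \<open>v\<close>.\<close>

definition cprod :: "(real^'d) set \<Rightarrow> (real^'d \<Rightarrow> complex) \<Rightarrow> (real^'d \<Rightarrow> complex) \<Rightarrow> complex" where
  "cprod \<Omega> u v = (LINT x:\<Omega>|lebesgue. u x * cnj (v x))"

definition cprod_vec ::
    "(real^'d) set \<Rightarrow> (real^'d \<Rightarrow> complex^'d) \<Rightarrow> (real^'d \<Rightarrow> complex^'d) \<Rightarrow> complex" where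
  "cprod_vec \<Omega> u v = (LINT x:\<Omega>|lebesgue. (\<Sum>i\<in>UNIV. u x $ i * cnj (v x $ i)))"

section \<open>Meshes and finite element spaces\<close>

text \<open>In dimension 2 a convex polygon, in dimension 3 a convex polyhedron.\<close>

definition convex_polytopal_domain :: "(real^'d) set \<Rightarrow> bool" where
  "convex_polytopal_domain \<Omega> \<longleftrightarrow>
     open \<Omega> \<and> bounded \<Omega> \<and> convex \<Omega> \<and> \<Omega> \<noteq> {} \<and> polytope (closure \<Omega>)"

definition mesh_size :: "(real^'d) set set \<Rightarrow> real" where
  "mesh_size \<T> = Max (diameter ` \<T>)"

definition simplicial_partition :: "(real^'d) set \<Rightarrow> (real^'d) set set \<Rightarrow> bool" where
  "simplicial_partition \<Omega> \<T> \<longleftrightarrow> finite \<T> \<and> (\<forall>K\<in>\<T>. int CARD('d) simplex K) \<and>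
     pairwise (\<lambda>K L. interior K \<inter> interior L = {}) \<T> \<and> \<Union>\<T> = closure \<Omega>"

text \<open>
  Quasi-uniformity with constant \<open>\<sigma>\<close>: the inradius of every cell is comparable to the mesh size.
\<close>

definition quasi_uniform :: "real \<Rightarrow> (real^'d) set set \<Rightarrow> bool" where
  "quasi_uniform \<sigma> \<T> \<longleftrightarrow> (\<forall>K\<in>\<T>. \<exists>x. cball x (\<sigma> * mesh_size \<T>) \<subseteq> K)"

text \<open>
  Polynomials of total degree at most \<open>r\<close>.  The multi-indices \<open>a :: 'd \<Rightarrow> nat\<close> range over a finite
  set.
\<close>

definition polynomials :: "nat \<Rightarrow> (real^'d \<Rightarrow> real) set" where
  "polynomials r = {p. \<exists>c::('d \<Rightarrow> nat) \<Rightarrow> real. \<forall>x.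
     p x = (\<Sum>a | (\<Sum>i\<in>UNIV. a i) \<le> r. c a * (\<Prod>i\<in>UNIV. x $ i ^ a i))}"

text \<open>
  Functions on \<open>closure \<Omega>\<close> are represented by total functions whose values outside
  \<open>closure \<Omega>\<close> are irrelevant.
\<close>

definition Vh :: "(real^'d) set \<Rightarrow> (real^'d) set set \<Rightarrow> nat \<Rightarrow> (real^'d \<Rightarrow> real) set" where
  "Vh \<Omega> \<T> r = {v. continuous_on (closure \<Omega>) v \<and> (\<forall>x\<in>frontier \<Omega>. v x = 0) \<and>
     (\<forall>K\<in>\<T>. \<exists>p\<in>polynomials r. \<forall>x\<in>K. v x = p x)}"

definition Vhc :: "(real^'d) set \<Rightarrow> (real^'d) set set \<Rightarrow> nat \<Rightarrow> (real^'d \<Rightarrow> complex) set" where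
  "Vhc \<Omega> \<T> r = {\<lambda>x. of_real (a x) + \<i> * of_real (b x) |a b. a \<in> Vh \<Omega> \<T> r \<and> b \<in> Vh \<Omega> \<T> r}"

text \<open>
  \<open>w = R\<^sub>h v\<close> for \<open>v \<in> H10 \<Omega>\<close>.  The choice of \<open>g\<close> is immaterial, because the weak gradient is unique
  up to null sets.
\<close>

definition is_ritz ::
    "(real^'d) set \<Rightarrow> (real^'d) set set \<Rightarrow> nat \<Rightarrow> (real^'d \<Rightarrow> real) \<Rightarrow> (real^'d \<Rightarrow> real) \<Rightarrow> bool" where
  "is_ritz \<Omega> \<T> r v w \<longleftrightarrow> w \<in> Vh \<Omega> \<T> r \<and>
     (\<exists>g. has_weak_gradient \<Omega> v g \<and>
        (\<forall>z\<in>Vh \<Omega> \<T> r. rprod \<Omega> (\<lambda>x. g x - grad w x) (grad z) = 0))"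

definition is_ritz_c ::
    "(real^'d) set \<Rightarrow> (real^'d) set set \<Rightarrow> nat \<Rightarrow> (real^'d \<Rightarrow> complex) \<Rightarrow> (real^'d \<Rightarrow> complex) \<Rightarrow> bool" where
  "is_ritz_c \<Omega> \<T> r v w \<longleftrightarrow>
     is_ritz \<Omega> \<T> r (\<lambda>x. Re (v x)) (\<lambda>x. Re (w x)) \<and> is_ritz \<Omega> \<T> r (\<lambda>x. Im (v x)) (\<lambda>x. Im (w x))"

section \<open>The fully discrete scheme\<close>

text \<open>Both are used for \<open>n \<ge> 1\<close> only.\<close>

definition diff_quot ::
    "real \<Rightarrow> (nat \<Rightarrow> real^'d \<Rightarrow> 'a::real_vector) \<Rightarrow> nat \<Rightarrow> real^'d \<Rightarrow> 'a" where
  "diff_quot \<tau> w n x = (w n x - w (n - 1) x) /\<^sub>R \<tau>"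

definition midpoint_avg :: "(nat \<Rightarrow> real^'d \<Rightarrow> 'a::real_vector) \<Rightarrow> nat \<Rightarrow> real^'d \<Rightarrow> 'a" where
  "midpoint_avg w n x = (w n x + w (n - 1) x) /\<^sub>R 2"

definition schroedinger_eq ::
    "(real^'d) set \<Rightarrow> (real^'d) set set \<Rightarrow> nat \<Rightarrow> real \<Rightarrow>
     (nat \<Rightarrow> real^'d \<Rightarrow> complex) \<Rightarrow> (nat \<Rightarrow> real^'d \<Rightarrow> real) \<Rightarrow> nat \<Rightarrow> bool" where
  "schroedinger_eq \<Omega> \<T> r \<tau> u \<phi> n \<longleftrightarrow> (\<forall>v\<in>Vhc \<Omega> \<T> r.
     \<i> * cprod \<Omega> (diff_quot \<tau> u n) v
     - cprod_vec \<Omega> (grad (midpoint_avg u n)) (grad v)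
     - cprod \<Omega> (\<lambda>x. of_real (midpoint_avg \<phi> n x) * midpoint_avg u n x) v = 0)"

text \<open>
  At \<open>n = 0\<close> this is not part of the scheme, and \<open>R\<^sub>h\<close>-projected initial data need not satisfy it.
  The energy balance between the levels 0 and 1 depends on it: for zero \<open>u\<close>, \<open>\<beta> > 0\<close> and nonzero
  \<open>\<phi> 0\<close> the energy drops to zero in the first step.
\<close>

definition poisson_eq ::
    "(real^'d) set \<Rightarrow> (real^'d) set set \<Rightarrow> nat \<Rightarrow> real \<Rightarrow> real \<Rightarrow>
     (nat \<Rightarrow> real^'d \<Rightarrow> complex) \<Rightarrow> (nat \<Rightarrow> real^'d \<Rightarrow> real) \<Rightarrow> nat \<Rightarrow> bool" where
  "poisson_eq \<Omega> \<T> r \<alpha> \<beta> u \<phi> n \<longleftrightarrow> (\<forall>w\<in>Vh \<Omega> \<T> r.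
     \<alpha> * rprod \<Omega> (\<phi> n) w + \<beta>\<^sup>2 * rprod \<Omega> (grad (\<phi> n)) (grad w)
     = rprod \<Omega> (\<lambda>x. (cmod (u n x))\<^sup>2) w)"

definition scheme_solution ::
    "(real^'d) set \<Rightarrow> (real^'d) set set \<Rightarrow> nat \<Rightarrow> real \<Rightarrow> real \<Rightarrow> real \<Rightarrow> nat \<Rightarrow>
     (real^'d \<Rightarrow> complex) \<Rightarrow> (real^'d \<Rightarrow> real) \<Rightarrow>
     (nat \<Rightarrow> real^'d \<Rightarrow> complex) \<Rightarrow> (nat \<Rightarrow> real^'d \<Rightarrow> real) \<Rightarrow> bool" where
  "scheme_solution \<Omega> \<T> r \<alpha> \<beta> \<tau> N u0 \<phi>0 u \<phi> \<longleftrightarrow>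
     is_ritz_c \<Omega> \<T> r u0 (u 0) \<and> is_ritz \<Omega> \<T> r \<phi>0 (\<phi> 0) \<and>
     (\<forall>n\<in>{1..N}. u n \<in> Vhc \<Omega> \<T> r \<and> \<phi> n \<in> Vh \<Omega> \<T> r \<and>
        schroedinger_eq \<Omega> \<T> r \<tau> u \<phi> n \<and> poisson_eq \<Omega> \<T> r \<alpha> \<beta> u \<phi> n)"

definition discrete_mass :: "(real^'d) set \<Rightarrow> (nat \<Rightarrow> real^'d \<Rightarrow> complex) \<Rightarrow> nat \<Rightarrow> real" where
  "discrete_mass \<Omega> u n = (L2_norm \<Omega> (u n))\<^sup>2"

definition discrete_energy ::
    "(real^'d) set \<Rightarrow> real \<Rightarrow> real \<Rightarrow>
     (nat \<Rightarrow> real^'d \<Rightarrow> complex) \<Rightarrow> (nat \<Rightarrow> real^'d \<Rightarrow> real) \<Rightarrow> nat \<Rightarrow> real" where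
  "discrete_energy \<Omega> \<alpha> \<beta> u \<phi> n =
     (L2_norm \<Omega> (grad (u n)))\<^sup>2 + \<alpha> / 2 * (L2_norm \<Omega> (\<phi> n))\<^sup>2
     + \<beta>\<^sup>2 / 2 * (L2_norm \<Omega> (grad (\<phi> n)))\<^sup>2"

end

theory Submission
  imports Defs
begin

text \<open>
  The proof is the discrete energy method.  Both balances come from testing the scheme with functions
  that lie in the finite element space, and both rest on the same polarisation identity
  \<open>\<langle>c (a - b), (a + b)/2\<rangle> = c/2 (\<parallel>a\<parallel>\<^sup>2 - \<parallel>b\<parallel>\<^sup>2)\<close>, lemma \<open>rprod_difference_mean\<close>.

  For the mass (\<open>mass_step\<close>), the Schroedinger equation is tested with the midpoint average of \<open>u\<close>.
  The gradient and potential terms are then real, so the imaginary part of the equation says that the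
  real inner product of the difference quotient with the average is zero.  By polarisation this is the
  difference of the masses of the two levels, up to a nonzero factor.

  For the energy (\<open>energy_step\<close>), it is tested with the difference quotient of \<open>u\<close>.  Now the time
  derivative term is purely imaginary.  In the real part, polarisation turns the gradient term into the
  difference of the kinetic energies, and the potential term into the pairing of the average of \<open>\<phi>\<close>
  with \<open>|u\<^sup>n|\<^sup>2 - |u\<^sup>n\<^sup>-\<^sup>1|\<^sup>2\<close>.  The Poisson equation at the levels \<open>n\<close> and \<open>n - 1\<close>, tested with that
  average, evaluates this pairing, and two more polarisations identify it with the difference of the
  potential energies.  The step needs the Poisson equation at both of its ends; since the scheme
  imposes it from level 1 on, the energy is constant from there, and from level 0 whenever
  the initial data satisfy it too.

  The analytic content is the justification of linearity of integrals and gradients.  A finite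
  element function agrees with a polynomial on each cell, so it is continuously differentiable, with
  bounded gradient, on the union of the open cells (\<open>bounded_C1_on_Vh\<close>).  The cells are convex, hence
  their boundaries are null sets (\<open>open_up_to_null_mesh\<close>), and all integrands that occur are bounded and
  continuous off a null set.
\<close>

section \<open>Bounded continuous integrands off a null set\<close>

text \<open>A class of integrands that is closed under the products and linear maps used below.\<close>

definition bcont :: "'a::topological_space set \<Rightarrow> ('a \<Rightarrow> 'b::metric_space) \<Rightarrow> bool" where
  "bcont G f \<longleftrightarrow> continuous_on G f \<and> bounded (f ` G)"

lemma bcont_cong: "(\<And>x. x \<in> G \<Longrightarrow> f x = g x) \<Longrightarrow> bcont G f = bcont G g"
  unfolding bcont_def by (simp cong: continuous_on_cong image_cong)

lemma bcont_bounded_linear: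
  assumes "bounded_linear L" and "bcont G f"
  shows "bcont G (\<lambda>x. L (f x))"
proof -
  have "bounded (L ` (f ` G))"
    using assms by (intro bounded_linear_image) (auto simp: bcont_def)
  then show ?thesis
    using assms by (auto simp: bcont_def image_image intro: bounded_linear.continuous_on)
qed

lemma bcont_bounded_bilinear:
  fixes f :: "'x::topological_space \<Rightarrow> 'a::real_normed_vector" and g :: "'x \<Rightarrow> 'b::real_normed_vector"
  assumes "bounded_bilinear B" and f: "bcont G f" and g: "bcont G g"
  shows "bcont G (\<lambda>x. B (f x) (g x))"
proof -
  interpret bounded_bilinear B by fact
  obtain a where a: "\<And>x. x \<in> G \<Longrightarrow> norm (f x) \<le> a"
    using f by (auto simp: bcont_def bounded_iff)
  obtain b where b: "\<And>x. x \<in> G \<Longrightarrow> norm (g x) \<le> b"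
    using g by (auto simp: bcont_def bounded_iff)
  obtain c where c: "c \<ge> 0" "\<And>y z. norm (B y z) \<le> norm y * norm z * c"
    using nonneg_bounded by blast
  have "norm (B (f x) (g x)) \<le> a * b * c" if "x \<in> G" for x
  proof -
    have "norm (f x) * norm (g x) * c \<le> a * b * c"
      using a[OF that] b[OF that] c(1) order_trans[OF norm_ge_zero a[OF that]]
      by (intro mult_right_mono mult_mono) auto
    then show ?thesis
      using c(2) order_trans by blast
  qed
  then have "bounded ((\<lambda>x. B (f x) (g x)) ` G)"
    by (auto simp: bounded_iff)
  then show ?thesis
    using f g by (auto simp: bcont_def intro: continuous_on)
qed

lemma bcont_add:
  fixes f g :: "_ \<Rightarrow> 'b::real_normed_vector"
  assumes "bcont G f" "bcont G g" shows "bcont G (\<lambda>x. f x + g x)"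
  using assms by (auto simp: bcont_def intro: continuous_on_add bounded_plus_comp)

lemma bcont_diff:
  fixes f g :: "_ \<Rightarrow> 'b::real_normed_vector"
  assumes "bcont G f" "bcont G g" shows "bcont G (\<lambda>x. f x - g x)"
  using assms by (auto simp: bcont_def intro: continuous_on_diff bounded_minus_comp)

lemma bcont_sum:
  fixes f :: "'i \<Rightarrow> _ \<Rightarrow> 'b::real_normed_vector"
  assumes "\<And>i. i \<in> I \<Longrightarrow> bcont G (f i)" shows "bcont G (\<lambda>x. \<Sum>i\<in>I. f i x)"
  using assms
proof (induction I rule: infinite_finite_induct)
  case (insert i I)
  then show ?case by (simp add: bcont_add)
qed (auto simp: bcont_def bounded_iff)

lemmas bcont_inner = bcont_bounded_bilinear[OF bounded_bilinear_inner]
lemmas bcont_mult = bcont_bounded_bilinear[OF bounded_bilinear_mult]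
lemmas bcont_scaleR = bcont_bounded_linear[OF bounded_linear_scaleR_right]

lemma bcont_vec:
  fixes f :: "_ \<Rightarrow> 'b::real_normed_vector ^ 'n"
  assumes "\<And>i. bcont G (\<lambda>x. f x $ i)" shows "bcont G f"
proof -
  obtain b where b: "\<And>i x. x \<in> G \<Longrightarrow> norm (f x $ i) \<le> b i"
    using assms unfolding bcont_def bounded_iff by (simp add: Ball_def image_iff) metis
  have "norm (f x) \<le> (\<Sum>i\<in>UNIV. b i)" if "x \<in> G" for x
    using L2_set_le_sum[of UNIV "\<lambda>i. norm (f x $ i)"] sum_mono[of UNIV "\<lambda>i. norm (f x $ i)" b] b[OF that]
    by (auto simp: norm_vec_def)
  then have "bounded (f ` G)"
    by (auto simp: bounded_iff)
  moreover have "continuous_on G (\<lambda>x. \<chi> i. f x $ i)"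
    using assms by (intro continuous_on_vec_lambda) (auto simp: bcont_def)
  ultimately show ?thesis
    by (simp add: bcont_def)
qed

lemma L2_norm_squared: "(L2_norm S f)\<^sup>2 = rprod S f f"
proof -
  have "0 \<le> (LINT x:S|lebesgue. (norm (f x))\<^sup>2)"
    unfolding set_lebesgue_integral_def by (rule Bochner_Integration.integral_nonneg) simp
  then show ?thesis
    by (simp add: L2_norm_def rprod_def power2_norm_eq_inner)
qed

text \<open>
  Finite element functions and their gradients are well behaved only inside the cells.  Every
  integral over \<open>\<Omega>\<close> is therefore computed on an open set \<open>G\<close> of full measure, where bounded continuous
  integrands are integrable.  Measurability on all of \<open>\<Omega>\<close> costs nothing, because Lebesgue measure is
  complete.
\<close>

locale open_up_to_null =
  fixes \<Omega> G :: "(real^'d) set"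
  assumes open_G: "open G" and G_subset: "G \<subseteq> \<Omega>" and bounded_G: "bounded G"
    and null_rest: "negligible (\<Omega> - G)"
begin

lemma bcont_integrable:
  fixes f :: "real^'d \<Rightarrow> 'b::euclidean_space"
  assumes "bcont G f"
  shows "set_integrable lebesgue \<Omega> f"
proof -
  have G: "G \<in> lmeasurable"
    using open_G bounded_G by (simp add: lmeasurable_open)
  obtain b where b: "\<And>x. x \<in> G \<Longrightarrow> norm (f x) \<le> b"
    using assms by (auto simp: bcont_def bounded_iff)
  have "f \<in> borel_measurable (lebesgue_on G)"
    using assms G by (auto simp: bcont_def fmeasurableD intro: continuous_imp_measurable_on_sets_lebesgue)
  moreover have "(\<lambda>x. b) integrable_on G"
    using G by (simp add: integrable_on_const)
  ultimately have "f absolutely_integrable_on G"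
    using b G by (intro measurable_bounded_by_integrable_imp_absolutely_integrable[where g="\<lambda>x. b"])
      (auto simp: fmeasurableD)
  then show ?thesis
    by (rule absolutely_integrable_spike_set)
      (use G_subset in \<open>auto intro: negligible_subset[OF null_rest] negligible_subset[OF negligible_empty]\<close>)
qed

lemma set_integral_cong_off_null:
  fixes f g :: "real^'d \<Rightarrow> 'b::euclidean_space"
  assumes "bcont G f" and eq: "\<And>x. x \<in> G \<Longrightarrow> f x = g x"
  shows "(LINT x:\<Omega>|lebesgue. f x) = (LINT x:\<Omega>|lebesgue. g x)"
proof -
  have "bcont G g"
    using assms bcont_cong by blast
  then have "(LINT x:\<Omega>|lebesgue. g x) = integral \<Omega> g" "(LINT x:\<Omega>|lebesgue. f x) = integral \<Omega> f"
    using assms by (auto intro!: set_lebesgue_integral_eq_integral bcont_integrable)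
  moreover have "integral \<Omega> f = integral \<Omega> g"
    by (rule integral_spike[OF null_rest]) (use eq in auto)
  ultimately show ?thesis by simp
qed

lemma rprod_diff_left:
  fixes a b c :: "real^'d \<Rightarrow> 'b::euclidean_space"
  assumes "bcont G a" "bcont G b" "bcont G c"
  shows "rprod \<Omega> (\<lambda>x. a x - b x) c = rprod \<Omega> a c - rprod \<Omega> b c"
  using assms by (simp add: rprod_def inner_diff_left set_integral_diff bcont_integrable bcont_inner)

text \<open>
  The polarisation identity behind every conservation law below.  The functions \<open>d\<close> and \<open>m\<close> are
  prescribed on \<open>G\<close> only, because the gradient of a linear combination is the combination of the gradients
  only where the functions are differentiable.
\<close>

lemma rprod_difference_mean:
  fixes a b d m :: "real^'d \<Rightarrow> 'b::euclidean_space"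
  assumes a: "bcont G a" and b: "bcont G b"
    and d: "\<And>x. x \<in> G \<Longrightarrow> d x = c *\<^sub>R (a x - b x)"
    and m: "\<And>x. x \<in> G \<Longrightarrow> m x = (a x + b x) /\<^sub>R 2"
  shows "rprod \<Omega> d m = c / 2 * ((L2_norm \<Omega> a)\<^sup>2 - (L2_norm \<Omega> b)\<^sup>2)"
proof -
  have "bcont G d" "bcont G m"
    using a b by (auto simp: d m bcont_add bcont_diff bcont_scaleR cong: bcont_cong)
  then have "rprod \<Omega> d m = (LINT x:\<Omega>|lebesgue. c / 2 * (a x \<bullet> a x - b x \<bullet> b x))"
    unfolding rprod_def
    by (intro set_integral_cong_off_null bcont_inner)
      (simp_all add: d m algebra_simps inner_commute)
  also have "\<dots> = c / 2 * (rprod \<Omega> a a - rprod \<Omega> b b)"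
    using a b by (simp add: rprod_def set_integral_diff bcont_integrable bcont_inner)
  finally show ?thesis
    by (simp add: L2_norm_squared)
qed

lemma Re_set_integral:
  fixes f :: "real^'d \<Rightarrow> complex"
  assumes "bcont G f"
  shows "Re (LINT x:\<Omega>|lebesgue. f x) = (LINT x:\<Omega>|lebesgue. Re (f x))"
  using bcont_integrable[OF assms]
  by (simp add: set_integrable_def set_lebesgue_integral_def flip: integral_Re)

text \<open>
  The real part of the Hermitian product is the Euclidean inner product of \<open>\<complex>\<close>, viewed as a real plane.
  This lets the real polarisation identity serve the complex-valued functions.
\<close>

lemma Re_cprod:
  assumes "bcont G u" "bcont G v"
  shows "Re (cprod \<Omega> u v) = rprod \<Omega> u v"
proof -
  have "bcont G (\<lambda>x. u x * cnj (v x))"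
    using assms by (intro bcont_mult bcont_bounded_linear[OF bounded_linear_cnj])
  then show ?thesis
    by (simp add: cprod_def rprod_def Re_set_integral inner_complex_def)
qed

lemma Re_cprod_vec:
  assumes "bcont G u" "bcont G v"
  shows "Re (cprod_vec \<Omega> u v) = rprod \<Omega> u v"
proof -
  have "bcont G (\<lambda>x. \<Sum>i\<in>UNIV. u x $ i * cnj (v x $ i))"
    using assms
    by (intro bcont_sum bcont_mult bcont_bounded_linear[OF bounded_linear_cnj]
        bcont_bounded_linear[OF bounded_linear_vec_nth])
  then show ?thesis
    by (simp add: cprod_vec_def rprod_def Re_set_integral inner_complex_def inner_vec_def)
qed

end

text \<open>
  The Bochner integral of a real-valued function is real even if the function is not integrable, since
  the integral is then 0.
\<close>

lemma Im_set_integral_real: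
  assumes "\<And>x. f x = complex_of_real (g x)"
  shows "Im (LINT x:S|lebesgue. f x) = 0"
proof -
  have "(LINT x:S|lebesgue. f x) = (LINT x|lebesgue. complex_of_real (indicat_real S x * g x))"
    by (simp add: set_lebesgue_integral_def assms scaleR_conv_of_real)
  then show ?thesis
    by (simp only: integral_complex_of_real Im_complex_of_real)
qed

lemma Im_cprod_real_weight: "Im (cprod S (\<lambda>x. of_real (w x) * v x) v) = 0"
  unfolding cprod_def
  by (rule Im_set_integral_real[where g="\<lambda>x. w x * (cmod (v x))\<^sup>2"])
    (simp add: complex_norm_square mult.assoc del: of_real_power)

lemma Im_cprod_self: "Im (cprod S v v) = 0"
  using Im_cprod_real_weight[of S "\<lambda>x. 1" v] by simp

lemma Im_cprod_vec_self: "Im (cprod_vec S v v) = 0"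
  unfolding cprod_vec_def
  by (rule Im_set_integral_real[where g="\<lambda>x. \<Sum>i\<in>UNIV. (cmod (v x $ i))\<^sup>2"])
    (simp add: complex_norm_square del: of_real_power)

section \<open>Finite element functions off the cell boundaries\<close>

text \<open>
  Differentiability has to be included: where \<open>f\<close> is not differentiable, its Frechet derivative, and
  hence \<open>grad f\<close>, is an arbitrary value with no linearity in \<open>f\<close>.
\<close>

definition bounded_C1_on :: "(real^'d) set \<Rightarrow> (real^'d \<Rightarrow> 'a::real_normed_vector) \<Rightarrow> bool" where
  "bounded_C1_on G f \<longleftrightarrow> bcont G f \<and> (\<forall>x\<in>G. f differentiable (at x)) \<and> bcont G (grad f)"

lemma grad_add:
  assumes "f differentiable (at x)" "g differentiable (at x)"
  shows "grad (\<lambda>x. f x + g x) x = grad f x + grad g x"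
proof -
  have "((\<lambda>x. f x + g x) has_derivative
      (\<lambda>h. frechet_derivative f (at x) h + frechet_derivative g (at x) h)) (at x)"
    using assms[THEN frechet_derivative_works[THEN iffD1]] by (rule has_derivative_add)
  from frechet_derivative_at[OF this, symmetric] show ?thesis
    by (simp add: grad_def partial_def vec_eq_iff)
qed

lemma grad_bounded_linear:
  assumes "bounded_linear L" "f differentiable (at x)"
  shows "grad (\<lambda>x. L (f x)) x = (\<chi> i. L (grad f x $ i))"
proof -
  have "((\<lambda>x. L (f x)) has_derivative (\<lambda>h. L (frechet_derivative f (at x) h))) (at x)"
    by (rule bounded_linear.has_derivative[OF assms(1) frechet_derivative_works[THEN iffD1, OF assms(2)]])
  then have "frechet_derivative (\<lambda>x. L (f x)) (at x) = (\<lambda>h. L (frechet_derivative f (at x) h))"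
    by (rule frechet_derivative_at[symmetric])
  then show ?thesis
    by (simp add: grad_def partial_def)
qed

lemma grad_scaleR:
  "f differentiable (at x) \<Longrightarrow> grad (\<lambda>x. c *\<^sub>R f x) x = c *\<^sub>R grad f x"
  by (simp add: grad_bounded_linear[OF bounded_linear_scaleR_right] vec_eq_iff)

lemma bounded_C1_on_add:
  assumes "bounded_C1_on G f" "bounded_C1_on G g"
  shows "bounded_C1_on G (\<lambda>x. f x + g x)"
proof -
  have "bcont G (\<lambda>x. grad f x + grad g x)"
    using assms by (intro bcont_add) (simp_all add: bounded_C1_on_def)
  moreover have "grad (\<lambda>x. f x + g x) x = grad f x + grad g x" if "x \<in> G" for x
    using assms that by (intro grad_add) (simp_all add: bounded_C1_on_def)
  ultimately have "bcont G (grad (\<lambda>x. f x + g x))"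
    by (simp cong: bcont_cong)
  then show ?thesis
    using assms by (simp add: bounded_C1_on_def bcont_add differentiable_add)
qed

lemma bounded_C1_on_bounded_linear:
  assumes L: "bounded_linear L" and f: "bounded_C1_on G f"
  shows "bounded_C1_on G (\<lambda>x. L (f x))"
proof -
  have "bcont G (\<lambda>x. (\<chi> i. L (grad f x $ i)))"
  proof (rule bcont_vec)
    show "bcont G (\<lambda>x. (\<chi> i. L (grad f x $ i)) $ i)" for i
      unfolding vec_lambda_beta
      by (rule bcont_bounded_linear[OF L], rule bcont_bounded_linear[OF bounded_linear_vec_nth])
        (use f in \<open>simp add: bounded_C1_on_def\<close>)
  qed
  moreover have "grad (\<lambda>x. L (f x)) x = (\<chi> i. L (grad f x $ i))" if "x \<in> G" for x
    using f that by (intro grad_bounded_linear[OF L]) (simp add: bounded_C1_on_def)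
  ultimately have "bcont G (grad (\<lambda>x. L (f x)))"
    by (simp cong: bcont_cong)
  moreover have "(\<lambda>x. L (f x)) differentiable (at x)" if "x \<in> G" for x
  proof -
    have "(f has_derivative frechet_derivative f (at x)) (at x)"
      using f that by (simp add: bounded_C1_on_def frechet_derivative_works)
    from bounded_linear.has_derivative[OF L this] show ?thesis
      by (rule differentiableI)
  qed
  moreover have "bcont G (\<lambda>x. L (f x))"
    using f by (intro bcont_bounded_linear[OF L]) (simp add: bounded_C1_on_def)
  ultimately show ?thesis
    by (simp add: bounded_C1_on_def)
qed

definition C1 :: "(real^'d \<Rightarrow> real) \<Rightarrow> bool" where
  "C1 f \<longleftrightarrow> (\<forall>x. f differentiable (at x)) \<and> (\<forall>i. continuous_on UNIV (partial i f))"

lemma C1_I: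
  assumes "\<And>x. (f has_derivative D x) (at x)" "\<And>i. continuous_on UNIV (\<lambda>x. D x (axis i 1))"
  shows "C1 f"
proof -
  have "frechet_derivative f (at x) = D x" for x
    using assms(1) frechet_derivative_at[symmetric] by blast
  then have "partial i f = (\<lambda>x. D x (axis i 1))" for i
    by (auto simp: partial_def)
  then show ?thesis
    using assms by (auto simp: C1_def differentiable_def)
qed

lemma C1_has_derivative: "C1 f \<Longrightarrow> (f has_derivative frechet_derivative f (at x)) (at x)"
  by (simp add: C1_def frechet_derivative_works)

lemma C1_continuous: "C1 f \<Longrightarrow> continuous_on S f"
  by (meson C1_def continuous_at_imp_continuous_on differentiable_imp_continuous_within)

lemma C1_continuous_partial:
  "C1 f \<Longrightarrow> continuous_on S (\<lambda>x. frechet_derivative f (at x) (axis i 1))"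
  unfolding C1_def partial_def[abs_def] using continuous_on_subset by blast

lemma C1_const: "C1 (\<lambda>x. c)"
  by (rule C1_I[where D="\<lambda>x h. 0"]) auto

lemma C1_nth: "C1 (\<lambda>x. x $ i)"
  by (rule C1_I[where D="\<lambda>x h. h $ i"]) (auto intro: derivative_eq_intros bounded_linear_imp_has_derivative bounded_linear_vec_nth)

lemma C1_add: "C1 f \<Longrightarrow> C1 g \<Longrightarrow> C1 (\<lambda>x. f x + g x)"
  by (rule C1_I[OF has_derivative_add[OF C1_has_derivative C1_has_derivative]])
    (auto intro!: continuous_intros C1_continuous_partial)

lemma C1_mult: "C1 f \<Longrightarrow> C1 g \<Longrightarrow> C1 (\<lambda>x. f x * g x)"
  by (rule C1_I[OF has_derivative_mult[OF C1_has_derivative C1_has_derivative]])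
    (auto intro!: continuous_on_add continuous_on_mult intro: C1_continuous C1_continuous_partial)

lemma C1_sum: "(\<And>i. i \<in> I \<Longrightarrow> C1 (f i)) \<Longrightarrow> C1 (\<lambda>x. \<Sum>i\<in>I. f i x)"
  by (induction I rule: infinite_finite_induct) (auto intro: C1_const C1_add)

lemma C1_prod: "(\<And>i. i \<in> I \<Longrightarrow> C1 (f i)) \<Longrightarrow> C1 (\<lambda>x. \<Prod>i\<in>I. f i x)"
  by (induction I rule: infinite_finite_induct) (auto intro: C1_const C1_mult)

lemma C1_power: "C1 f \<Longrightarrow> C1 (\<lambda>x. f x ^ n)"
  by (induction n) (auto intro: C1_const C1_mult)

lemma C1_polynomials:
  assumes "p \<in> polynomials r" shows "C1 p"
proof -
  obtain c where "\<And>x. p x = (\<Sum>a | (\<Sum>i\<in>UNIV. a i) \<le> r. c a * (\<Prod>i\<in>UNIV. x $ i ^ a i))"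
    using assms by (auto simp: polynomials_def)
  then have "p = (\<lambda>x. \<Sum>a | (\<Sum>i\<in>UNIV. a i) \<le> r. c a * (\<Prod>i\<in>UNIV. x $ i ^ a i))"
    by (rule ext)
  then show ?thesis
    by (auto intro!: C1_sum C1_mult C1_const C1_prod C1_power C1_nth)
qed

lemma C1_continuous_grad: "C1 p \<Longrightarrow> continuous_on S (grad p)"
  unfolding grad_def[abs_def] partial_def
  by (intro continuous_on_vec_lambda C1_continuous_partial)

text \<open>The gradient is local: on an open cell it is that of the polynomial which represents the function.\<close>

lemma grad_eq_on_interior:
  assumes x: "x \<in> interior K" and eq: "\<And>y. y \<in> K \<Longrightarrow> f y = p y" and p: "p differentiable (at x)"
  shows "f differentiable (at x)" "grad f x = grad p x"
proof -
  have "(p has_derivative frechet_derivative p (at x)) (at x)"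
    using p by (simp add: frechet_derivative_works)
  then have *: "(f has_derivative frechet_derivative p (at x)) (at x)"
    by (rule has_derivative_transform_within_open[OF _ open_interior x])
      (simp add: eq interior_subset[THEN subsetD])
  then show "f differentiable (at x)"
    by (auto simp: differentiable_def)
  show "grad f x = grad p x"
    using frechet_derivative_at[symmetric, OF *] by (simp add: grad_def partial_def)
qed

text \<open>
  Continuity of the gradient is local, so it holds on the union of the open cells.  Boundedness
  holds because each gradient of a polynomial is bounded on its compact cell and there are finitely
  many cells.
\<close>

lemma bounded_C1_on_Vh:
  assumes \<Omega>: "bounded \<Omega>" "open \<Omega>" and part: "simplicial_partition \<Omega> \<T>" and v: "v \<in> Vh \<Omega> \<T> r"
  shows "bounded_C1_on (\<Omega> \<inter> (\<Union>K\<in>\<T>. interior K)) v"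
proof -
  define G where "G = \<Omega> \<inter> (\<Union>K\<in>\<T>. interior K)"
  have "compact (v ` closure \<Omega>)"
    using \<Omega> v by (intro compact_continuous_image) (auto simp: Vh_def)
  then have v_bcont: "bcont G v"
    using v unfolding bcont_def G_def Vh_def
    by (auto intro: continuous_on_subset bounded_subset[OF compact_imp_bounded] closure_subset[THEN subsetD])
  obtain p where p: "\<And>K. K \<in> \<T> \<Longrightarrow> p K \<in> polynomials r" "\<And>K x. K \<in> \<T> \<Longrightarrow> x \<in> K \<Longrightarrow> v x = p K x"
    using v unfolding Vh_def by simp metis
  have C1: "C1 (p K)" if "K \<in> \<T>" for K
    using p(1)[OF that] by (rule C1_polynomials)
  have v_interior: "v differentiable (at x)" "grad v x = grad (p K) x" if "K \<in> \<T>" "x \<in> interior K" for x K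
    using grad_eq_on_interior[OF that(2) p(2)[OF that(1)]] C1[OF that(1)] by (simp_all add: C1_def)
  have "continuous_on (interior K) (grad v)" if "K \<in> \<T>" for K
    using C1_continuous_grad[OF C1[OF that]] v_interior(2)[OF that] by (simp cong: continuous_on_cong)
  then have "continuous_on (\<Union>K\<in>\<T>. interior K) (grad v)"
    by (intro continuous_on_open_UN) auto
  then have "continuous_on G (grad v)"
    by (rule continuous_on_subset) (auto simp: G_def)
  moreover have "bounded (\<Union>K\<in>\<T>. grad (p K) ` K)"
  proof -
    have "bounded (grad (p K) ` K)" if "K \<in> \<T>" for K
    proof -
      have "compact K"
        using part that by (auto simp: simplicial_partition_def intro: compact_simplex)
      then show ?thesis
        by (intro compact_imp_bounded compact_continuous_image C1_continuous_grad C1 that)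
    qed
    then show ?thesis
      using part by (auto simp: simplicial_partition_def)
  qed
  then have "bounded (grad v ` G)"
    by (rule bounded_subset) (use v_interior(2) interior_subset in \<open>fastforce simp: G_def\<close>)
  ultimately show ?thesis
    using v_bcont v_interior(1) unfolding bounded_C1_on_def bcont_def G_def by auto
qed

text \<open>Since the closed cells cover \<open>\<Omega>\<close>, only their frontiers are left out, which are null by convexity.\<close>

lemma open_up_to_null_mesh:
  assumes \<Omega>: "bounded \<Omega>" "open \<Omega>" and part: "simplicial_partition \<Omega> \<T>"
  shows "open_up_to_null \<Omega> (\<Omega> \<inter> (\<Union>K\<in>\<T>. interior K))"
proof
  have cells: "finite \<T>" "\<Union>\<T> = closure \<Omega>" "\<And>K. K \<in> \<T> \<Longrightarrow> convex K"
    using part by (auto simp: simplicial_partition_def intro: convex_simplex)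
  have "\<Omega> - (\<Omega> \<inter> (\<Union>K\<in>\<T>. interior K)) \<subseteq> (\<Union>K\<in>\<T>. frontier K)"
  proof
    fix x assume x: "x \<in> \<Omega> - (\<Omega> \<inter> (\<Union>K\<in>\<T>. interior K))"
    then obtain K where "K \<in> \<T>" "x \<in> K"
      using cells(2) closure_subset[of \<Omega>] by blast
    with x show "x \<in> (\<Union>K\<in>\<T>. frontier K)"
      using closure_subset[of K] by (auto simp: frontier_def)
  qed
  moreover have "negligible (\<Union>K\<in>\<T>. frontier K)"
    using cells by (auto intro!: negligible_Union negligible_convex_frontier)
  ultimately show "negligible (\<Omega> - (\<Omega> \<inter> (\<Union>K\<in>\<T>. interior K)))"
    using negligible_subset by blast
qed (use \<Omega> in \<open>auto intro!: bounded_Int\<close>)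

lemma polynomials_lincomb:
  assumes "p \<in> polynomials r" "q \<in> polynomials r"
  shows "(\<lambda>x. s * p x + t * q x) \<in> polynomials r"
proof -
  obtain c d where c: "\<And>x. p x = (\<Sum>a | (\<Sum>i\<in>UNIV. a i) \<le> r. c a * (\<Prod>i\<in>UNIV. x $ i ^ a i))"
    and d: "\<And>x. q x = (\<Sum>a | (\<Sum>i\<in>UNIV. a i) \<le> r. d a * (\<Prod>i\<in>UNIV. x $ i ^ a i))"
    using assms by (auto simp: polynomials_def)
  have "s * p x + t * q x = (\<Sum>a | (\<Sum>i\<in>UNIV. a i) \<le> r. (s * c a + t * d a) * (\<Prod>i\<in>UNIV. x $ i ^ a i))" for x
    by (simp add: c d sum_distrib_left sum.distrib algebra_simps)
  then show ?thesis
    unfolding polynomials_def by (intro CollectI exI[of _ "\<lambda>a. s * c a + t * d a"]) auto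
qed

lemma Vh_polynomial_on_cell:
  "v \<in> Vh \<Omega> \<T> r \<Longrightarrow> K \<in> \<T> \<Longrightarrow> \<exists>p\<in>polynomials r. \<forall>x\<in>K. v x = p x"
  by (simp add: Vh_def)

lemma Vh_lincomb:
  assumes v: "v \<in> Vh \<Omega> \<T> r" and w: "w \<in> Vh \<Omega> \<T> r"
  shows "(\<lambda>x. s * v x + t * w x) \<in> Vh \<Omega> \<T> r"
proof -
  have "\<exists>p\<in>polynomials r. \<forall>x\<in>K. s * v x + t * w x = p x" if K: "K \<in> \<T>" for K
  proof -
    obtain p where p: "p \<in> polynomials r" "\<forall>x\<in>K. v x = p x"
      using Vh_polynomial_on_cell[OF v K] by (elim bexE)
    obtain q where q: "q \<in> polynomials r" "\<forall>x\<in>K. w x = q x"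
      using Vh_polynomial_on_cell[OF w K] by (elim bexE)
    show ?thesis
      using p q
      by (intro bexI[OF _ polynomials_lincomb[of p r q s t]]) auto
  qed
  then show ?thesis
    using v w by (auto simp: Vh_def intro!: continuous_intros)
qed

lemma VhcI:
  "a \<in> Vh \<Omega> \<T> r \<Longrightarrow> b \<in> Vh \<Omega> \<T> r \<Longrightarrow> (\<lambda>x. of_real (a x) + \<i> * of_real (b x)) \<in> Vhc \<Omega> \<T> r"
  by (auto simp: Vhc_def)

lemma Vhc_lincomb:
  assumes "v \<in> Vhc \<Omega> \<T> r" "w \<in> Vhc \<Omega> \<T> r"
  shows "(\<lambda>x. s *\<^sub>R v x + t *\<^sub>R w x) \<in> Vhc \<Omega> \<T> r"
proof -
  obtain a b c d where v: "v = (\<lambda>x. of_real (a x) + \<i> * of_real (b x))"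
    and w: "w = (\<lambda>x. of_real (c x) + \<i> * of_real (d x))"
    and *: "a \<in> Vh \<Omega> \<T> r" "b \<in> Vh \<Omega> \<T> r" "c \<in> Vh \<Omega> \<T> r" "d \<in> Vh \<Omega> \<T> r"
    using assms by (auto simp: Vhc_def)
  have "(\<lambda>x. s *\<^sub>R v x + t *\<^sub>R w x)
      = (\<lambda>x. of_real (s * a x + t * c x) + \<i> * of_real (s * b x + t * d x))"
    by (auto simp: v w complex_eq_iff)
  then show ?thesis
    using * by (simp only:) (intro VhcI Vh_lincomb)
qed

lemma bounded_C1_on_Vhc:
  assumes "bounded \<Omega>" "open \<Omega>" "simplicial_partition \<Omega> \<T>" "v \<in> Vhc \<Omega> \<T> r"
  shows "bounded_C1_on (\<Omega> \<inter> (\<Union>K\<in>\<T>. interior K)) v"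
proof -
  obtain a b where v: "v = (\<lambda>x. of_real (a x) + \<i> * of_real (b x))"
    and ab: "a \<in> Vh \<Omega> \<T> r" "b \<in> Vh \<Omega> \<T> r"
    using assms(4) by (auto simp: Vhc_def)
  have "bounded_linear (\<lambda>t. \<i> * complex_of_real t)"
    by (intro bounded_linear_const_mult bounded_linear_of_real)
  then show ?thesis
    unfolding v using bounded_C1_on_Vh[OF assms(1-3)] ab
    by (intro bounded_C1_on_add bounded_C1_on_bounded_linear[OF bounded_linear_of_real]
        bounded_C1_on_bounded_linear[where L="\<lambda>t. \<i> * complex_of_real t"]) auto
qed

section \<open>One time step\<close>

lemma midpoint_avg_lincomb:
  "midpoint_avg w n = (\<lambda>x. inverse 2 *\<^sub>R w n x + inverse 2 *\<^sub>R w (n - 1) x)"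
  by (rule ext) (simp only: midpoint_avg_def scaleR_add_right)

lemma diff_quot_lincomb:
  "diff_quot \<tau> w n = (\<lambda>x. inverse \<tau> *\<^sub>R w n x + (- inverse \<tau>) *\<^sub>R w (n - 1) x)"
  by (rule ext) (simp only: diff_quot_def scaleR_diff_right scaleR_minus_left add_uminus_conv_diff)

lemma grad_lincomb:
  assumes "f differentiable (at x)" "g differentiable (at x)"
  shows "grad (\<lambda>x. s *\<^sub>R f x + t *\<^sub>R g x) x = s *\<^sub>R grad f x + t *\<^sub>R grad g x"
proof -
  have "(\<lambda>x. s *\<^sub>R f x) differentiable (at x)" "(\<lambda>x. t *\<^sub>R g x) differentiable (at x)"
    using assms by (auto intro: differentiable_scaleR[OF differentiable_const])
  then show ?thesis
    by (simp only: grad_add grad_scaleR[OF assms(1)] grad_scaleR[OF assms(2)])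
qed

lemma grad_diff_quot:
  assumes "w n differentiable (at x)" "w (n - 1) differentiable (at x)"
  shows "grad (diff_quot \<tau> w n) x = inverse \<tau> *\<^sub>R (grad (w n) x - grad (w (n - 1)) x)"
  unfolding diff_quot_lincomb grad_lincomb[OF assms]
  by (simp only: scaleR_diff_right scaleR_minus_left add_uminus_conv_diff)

lemma grad_midpoint_avg:
  assumes "w n differentiable (at x)" "w (n - 1) differentiable (at x)"
  shows "grad (midpoint_avg w n) x = (grad (w n) x + grad (w (n - 1)) x) /\<^sub>R 2"
  unfolding midpoint_avg_lincomb grad_lincomb[OF assms] by (simp only: scaleR_add_right)

text \<open>Tested with the midpoint average, whose gradient and potential terms have no imaginary part.\<close>

lemma mass_step:
  assumes \<Omega>: "bounded \<Omega>" "open \<Omega>" and part: "simplicial_partition \<Omega> \<T>" and \<tau>: "\<tau> \<noteq> 0"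
    and u: "u n \<in> Vhc \<Omega> \<T> r" "u (n - 1) \<in> Vhc \<Omega> \<T> r"
    and eq: "schroedinger_eq \<Omega> \<T> r \<tau> u \<phi> n"
  shows "discrete_mass \<Omega> u n = discrete_mass \<Omega> u (n - 1)"
proof -
  define G where "G = \<Omega> \<inter> (\<Union>K\<in>\<T>. interior K)"
  interpret open_up_to_null \<Omega> G
    unfolding G_def using \<Omega> part by (rule open_up_to_null_mesh)
  let ?m = "midpoint_avg u n" and ?d = "diff_quot \<tau> u n"
  have m: "?m \<in> Vhc \<Omega> \<T> r" and d: "?d \<in> Vhc \<Omega> \<T> r"
    unfolding midpoint_avg_lincomb diff_quot_lincomb by (rule Vhc_lincomb[OF u])+
  have bc: "bcont G v" if "v \<in> Vhc \<Omega> \<T> r" for v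
    using bounded_C1_on_Vhc[OF \<Omega> part that] by (simp add: G_def bounded_C1_on_def)
  have "\<i> * cprod \<Omega> ?d ?m - cprod_vec \<Omega> (grad ?m) (grad ?m)
      - cprod \<Omega> (\<lambda>x. of_real (midpoint_avg \<phi> n x) * ?m x) ?m = 0"
    using eq m by (simp add: schroedinger_eq_def)
  from arg_cong[OF this, of Im] have "Re (cprod \<Omega> ?d ?m) = 0"
    by (simp add: Im_cprod_real_weight Im_cprod_vec_self)
  then have "rprod \<Omega> ?d ?m = 0"
    by (simp add: Re_cprod bc m d)
  moreover have "rprod \<Omega> ?d ?m = inverse \<tau> / 2 * ((L2_norm \<Omega> (u n))\<^sup>2 - (L2_norm \<Omega> (u (n - 1)))\<^sup>2)"
    using u by (intro rprod_difference_mean bc) (simp_all add: diff_quot_def midpoint_avg_def)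
  ultimately show ?thesis
    using \<tau> by (simp add: discrete_mass_def)
qed

text \<open>
  Tested with the difference quotient.  The Poisson equation is a hypothesis at both levels because
  the difference of the two charge densities \<open>|u|\<^sup>2\<close> has to be expressed through \<open>\<phi>\<close>.
\<close>

lemma energy_step:
  assumes \<Omega>: "bounded \<Omega>" "open \<Omega>" and part: "simplicial_partition \<Omega> \<T>" and \<tau>: "\<tau> \<noteq> 0"
    and u: "u n \<in> Vhc \<Omega> \<T> r" "u (n - 1) \<in> Vhc \<Omega> \<T> r"
    and \<phi>: "\<phi> n \<in> Vh \<Omega> \<T> r" "\<phi> (n - 1) \<in> Vh \<Omega> \<T> r"
    and eq: "schroedinger_eq \<Omega> \<T> r \<tau> u \<phi> n"
    and poisson: "poisson_eq \<Omega> \<T> r \<alpha> \<beta> u \<phi> n" "poisson_eq \<Omega> \<T> r \<alpha> \<beta> u \<phi> (n - 1)"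
  shows "discrete_energy \<Omega> \<alpha> \<beta> u \<phi> n = discrete_energy \<Omega> \<alpha> \<beta> u \<phi> (n - 1)"
proof -
  define G where "G = \<Omega> \<inter> (\<Union>K\<in>\<T>. interior K)"
  interpret open_up_to_null \<Omega> G
    unfolding G_def using \<Omega> part by (rule open_up_to_null_mesh)
  let ?m = "midpoint_avg u n" and ?d = "diff_quot \<tau> u n" and ?p = "midpoint_avg \<phi> n"
  let ?ptl = "\<lambda>x. complex_of_real (?p x) * ?m x"
  have m: "?m \<in> Vhc \<Omega> \<T> r" and d: "?d \<in> Vhc \<Omega> \<T> r"
    unfolding midpoint_avg_lincomb diff_quot_lincomb by (rule Vhc_lincomb[OF u])+
  have p: "?p \<in> Vh \<Omega> \<T> r"
    unfolding midpoint_avg_lincomb real_scaleR_def by (rule Vh_lincomb[OF \<phi>])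
  have C1c: "bcont G v" "bcont G (grad v)" "\<And>x. x \<in> G \<Longrightarrow> v differentiable (at x)"
    if "v \<in> Vhc \<Omega> \<T> r" for v
    using bounded_C1_on_Vhc[OF \<Omega> part that] by (auto simp: G_def bounded_C1_on_def)
  have C1: "bcont G v" "bcont G (grad v)" "\<And>x. x \<in> G \<Longrightarrow> v differentiable (at x)"
    if "v \<in> Vh \<Omega> \<T> r" for v
    using bounded_C1_on_Vh[OF \<Omega> part that] by (auto simp: G_def bounded_C1_on_def)
  have grad_d: "grad ?d x = inverse \<tau> *\<^sub>R (grad (u n) x - grad (u (n - 1)) x)"
    and grad_m: "grad ?m x = (grad (u n) x + grad (u (n - 1)) x) /\<^sub>R 2" if "x \<in> G" for x
    using C1c(3)[OF u(1) that] C1c(3)[OF u(2) that] by (rule grad_diff_quot, rule grad_midpoint_avg)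
  have grad_p: "grad ?p x = (grad (\<phi> n) x + grad (\<phi> (n - 1)) x) /\<^sub>R 2" if "x \<in> G" for x
    using C1(3)[OF \<phi>(1) that] C1(3)[OF \<phi>(2) that] by (rule grad_midpoint_avg)
  have ptl: "bcont G ?ptl"
    using m p by (intro bcont_mult bcont_bounded_linear[OF bounded_linear_of_real] C1 C1c)
  have sq: "bcont G (\<lambda>x. (cmod (u k x))\<^sup>2)" if "u k \<in> Vhc \<Omega> \<T> r" for k
    unfolding power2_norm_eq_inner using that by (intro bcont_inner C1c)

  (* The first term is purely imaginary, so it drops out of the real part. *)
  have "\<i> * cprod \<Omega> ?d ?d - cprod_vec \<Omega> (grad ?m) (grad ?d) - cprod \<Omega> ?ptl ?d = 0"
    using eq d by (simp add: schroedinger_eq_def)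
  from arg_cong[OF this, of Re]
  have "rprod \<Omega> (grad ?m) (grad ?d) + rprod \<Omega> ?ptl ?d = 0"
    by (simp add: Im_cprod_self Re_cprod Re_cprod_vec C1c ptl m d)
  moreover have "rprod \<Omega> (grad ?m) (grad ?d)
      = inverse \<tau> / 2 * ((L2_norm \<Omega> (grad (u n)))\<^sup>2 - (L2_norm \<Omega> (grad (u (n - 1))))\<^sup>2)"
  proof -
    have "rprod \<Omega> (grad ?d) (grad ?m)
      = inverse \<tau> / 2 * ((L2_norm \<Omega> (grad (u n)))\<^sup>2 - (L2_norm \<Omega> (grad (u (n - 1))))\<^sup>2)"
      by (rule rprod_difference_mean[OF C1c(2)[OF u(1)] C1c(2)[OF u(2)] grad_d grad_m])
    then show ?thesis
      by (simp add: rprod_def inner_commute)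
  qed
  moreover have "rprod \<Omega> ?ptl ?d
      = inverse \<tau> / 2 * (rprod \<Omega> (\<lambda>x. (cmod (u n x))\<^sup>2) ?p - rprod \<Omega> (\<lambda>x. (cmod (u (n - 1) x))\<^sup>2) ?p)"
  proof -
    have "?ptl x \<bullet> ?d x
        = inverse \<tau> / 2 * (((cmod (u n x))\<^sup>2 - (cmod (u (n - 1) x))\<^sup>2) \<bullet> ?p x)" for x
    proof -
      let ?a = "u n x" and ?b = "u (n - 1) x"
      have "?ptl x \<bullet> ?d x = (?p x *\<^sub>R (inverse 2 *\<^sub>R (?a + ?b))) \<bullet> (inverse \<tau> *\<^sub>R (?a - ?b))"
        by (simp only: scaleR_conv_of_real midpoint_avg_def[of u] diff_quot_def)
      also have "\<dots> = inverse \<tau> / 2 * (?p x * ((?a + ?b) \<bullet> (?a - ?b)))"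
        unfolding inner_scaleR_left inner_scaleR_right by (simp only: divide_inverse mult_ac)
      also have "(?a + ?b) \<bullet> (?a - ?b) = (cmod ?a)\<^sup>2 - (cmod ?b)\<^sup>2"
        unfolding power2_norm_eq_inner inner_add_left inner_diff_right by (simp add: inner_commute)
      finally show ?thesis
        by (simp only: inner_real_def mult.commute)
    qed
    then have "rprod \<Omega> ?ptl ?d
        = inverse \<tau> / 2 * rprod \<Omega> (\<lambda>x. (cmod (u n x))\<^sup>2 - (cmod (u (n - 1) x))\<^sup>2) ?p"
      unfolding rprod_def by (simp only: set_integral_mult_right)
    also have "rprod \<Omega> (\<lambda>x. (cmod (u n x))\<^sup>2 - (cmod (u (n - 1) x))\<^sup>2) ?p
        = rprod \<Omega> (\<lambda>x. (cmod (u n x))\<^sup>2) ?p - rprod \<Omega> (\<lambda>x. (cmod (u (n - 1) x))\<^sup>2) ?p"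
      using u p by (intro rprod_diff_left sq C1)
    finally show ?thesis .
  qed
  ultimately have "inverse \<tau> / 2 * (((L2_norm \<Omega> (grad (u n)))\<^sup>2 - (L2_norm \<Omega> (grad (u (n - 1))))\<^sup>2)
      + (rprod \<Omega> (\<lambda>x. (cmod (u n x))\<^sup>2) ?p - rprod \<Omega> (\<lambda>x. (cmod (u (n - 1) x))\<^sup>2) ?p)) = 0"
    by (simp only: distrib_left)
  then have kinetic: "((L2_norm \<Omega> (grad (u n)))\<^sup>2 - (L2_norm \<Omega> (grad (u (n - 1))))\<^sup>2)
      + (rprod \<Omega> (\<lambda>x. (cmod (u n x))\<^sup>2) ?p - rprod \<Omega> (\<lambda>x. (cmod (u (n - 1) x))\<^sup>2) ?p) = 0"
    using \<tau> by simp

  (* Polarisation for phi and for its gradient, with factor c = 1. *)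
  have "rprod \<Omega> (\<phi> n) ?p - rprod \<Omega> (\<phi> (n - 1)) ?p = rprod \<Omega> (\<lambda>x. \<phi> n x - \<phi> (n - 1) x) ?p"
    using \<phi> p by (simp add: rprod_diff_left C1)
  also have "\<dots> = 1 / 2 * ((L2_norm \<Omega> (\<phi> n))\<^sup>2 - (L2_norm \<Omega> (\<phi> (n - 1)))\<^sup>2)"
    using \<phi> by (intro rprod_difference_mean C1) (simp_all add: midpoint_avg_def)
  finally have 1: "rprod \<Omega> (\<phi> n) ?p - rprod \<Omega> (\<phi> (n - 1)) ?p
      = 1 / 2 * ((L2_norm \<Omega> (\<phi> n))\<^sup>2 - (L2_norm \<Omega> (\<phi> (n - 1)))\<^sup>2)" .
  have "rprod \<Omega> (grad (\<phi> n)) (grad ?p) - rprod \<Omega> (grad (\<phi> (n - 1))) (grad ?p)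
      = rprod \<Omega> (\<lambda>x. grad (\<phi> n) x - grad (\<phi> (n - 1)) x) (grad ?p)"
    using \<phi> p by (simp add: rprod_diff_left C1)
  also have "\<dots> = 1 / 2 * ((L2_norm \<Omega> (grad (\<phi> n)))\<^sup>2 - (L2_norm \<Omega> (grad (\<phi> (n - 1))))\<^sup>2)"
    by (rule rprod_difference_mean[OF C1(2)[OF \<phi>(1)] C1(2)[OF \<phi>(2)] _ grad_p]) simp
  finally have 2: "rprod \<Omega> (grad (\<phi> n)) (grad ?p) - rprod \<Omega> (grad (\<phi> (n - 1))) (grad ?p)
      = 1 / 2 * ((L2_norm \<Omega> (grad (\<phi> n)))\<^sup>2 - (L2_norm \<Omega> (grad (\<phi> (n - 1))))\<^sup>2)" .
  have "rprod \<Omega> (\<lambda>x. (cmod (u n x))\<^sup>2) ?p - rprod \<Omega> (\<lambda>x. (cmod (u (n - 1) x))\<^sup>2) ?p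
      = \<alpha> * (rprod \<Omega> (\<phi> n) ?p - rprod \<Omega> (\<phi> (n - 1)) ?p)
        + \<beta>\<^sup>2 * (rprod \<Omega> (grad (\<phi> n)) (grad ?p) - rprod \<Omega> (grad (\<phi> (n - 1))) (grad ?p))"
    using poisson p by (simp add: poisson_eq_def algebra_simps)
  then show ?thesis
    using kinetic unfolding 1 2 discrete_energy_def by (simp add: algebra_simps)
qed

theorem theorem3p1:
  fixes \<Omega> :: "(real^'d) set" and \<T> :: "(real^'d) set set"
    and r N :: nat and \<sigma> \<alpha> \<beta> T \<tau> :: real
    and u0 :: "real^'d \<Rightarrow> complex" and \<phi>0 :: "real^'d \<Rightarrow> real"
    and u :: "nat \<Rightarrow> real^'d \<Rightarrow> complex" and \<phi> :: "nat \<Rightarrow> real^'d \<Rightarrow> real"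
  assumes "CARD('d) = 2 \<or> CARD('d) = 3"
    and "convex_polytopal_domain \<Omega>"
    and "T > 0" and "\<alpha> \<ge> 0" and "\<beta> \<ge> 0"
    and "u0 \<in> H10c \<Omega>" and "\<phi>0 \<in> H10 \<Omega>"
    and "simplicial_partition \<Omega> \<T>" and "\<sigma> > 0" and "quasi_uniform \<sigma> \<T>"
    and "r \<ge> 1"
    and "N \<ge> 1" and "\<tau> = T / real N"
    and "scheme_solution \<Omega> \<T> r \<alpha> \<beta> \<tau> N u0 \<phi>0 u \<phi>"
  shows "(\<forall>n\<in>{1..N}. discrete_mass \<Omega> u n = discrete_mass \<Omega> u 0) \<and>
         (\<forall>n\<in>{1..N}. discrete_energy \<Omega> \<alpha> \<beta> u \<phi> n = discrete_energy \<Omega> \<alpha> \<beta> u \<phi> 1) \<and>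
         (poisson_eq \<Omega> \<T> r \<alpha> \<beta> u \<phi> 0 \<longrightarrow>
            (\<forall>n\<in>{1..N}. discrete_energy \<Omega> \<alpha> \<beta> u \<phi> n = discrete_energy \<Omega> \<alpha> \<beta> u \<phi> 0))"
proof -
  have \<Omega>: "bounded \<Omega>" "open \<Omega>"
    using assms(2) by (auto simp: convex_polytopal_domain_def)
  have \<tau>: "\<tau> \<noteq> 0"
    using assms by auto
  note part = \<open>simplicial_partition \<Omega> \<T>\<close> and scheme = assms(14)[unfolded scheme_solution_def]
  have u: "u n \<in> Vhc \<Omega> \<T> r" and \<phi>: "\<phi> n \<in> Vh \<Omega> \<T> r" if "n \<le> N" for n
  proof -
    (* The Ritz projection puts the initial level into the finite element space, too. *)
    have "(\<lambda>x. Re (u 0 x)) \<in> Vh \<Omega> \<T> r" "(\<lambda>x. Im (u 0 x)) \<in> Vh \<Omega> \<T> r"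
      using scheme by (auto simp: is_ritz_c_def is_ritz_def)
    from VhcI[OF this] have "u 0 \<in> Vhc \<Omega> \<T> r"
      by (simp flip: complex_eq)
    moreover have "\<phi> 0 \<in> Vh \<Omega> \<T> r"
      using scheme by (auto simp: is_ritz_def)
    ultimately show "u n \<in> Vhc \<Omega> \<T> r" "\<phi> n \<in> Vh \<Omega> \<T> r"
      using scheme that by (cases n; auto)+
  qed
  have mass: "discrete_mass \<Omega> u (Suc n) = discrete_mass \<Omega> u n" if "Suc n \<le> N" for n
    using mass_step[OF \<Omega> part \<tau>, of u "Suc n" r \<phi>] u[of n] u[of "Suc n"] that scheme by auto
  have energy: "discrete_energy \<Omega> \<alpha> \<beta> u \<phi> (Suc n) = discrete_energy \<Omega> \<alpha> \<beta> u \<phi> n"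
    if "Suc n \<le> N" "poisson_eq \<Omega> \<T> r \<alpha> \<beta> u \<phi> n" for n
    using energy_step[OF \<Omega> part \<tau>, of u "Suc n" r \<phi> \<alpha> \<beta>] u[of n] u[of "Suc n"] \<phi>[of n] \<phi>[of "Suc n"]
      that scheme by auto
  have mass0: "discrete_mass \<Omega> u n = discrete_mass \<Omega> u 0" if "n \<in> {1..N}" for n
  proof -
    from that have "n \<le> N" by simp
    then show ?thesis
      by (induction n) (auto simp: mass)
  qed
  have energy1: "discrete_energy \<Omega> \<alpha> \<beta> u \<phi> n = discrete_energy \<Omega> \<alpha> \<beta> u \<phi> 1" if "n \<in> {1..N}" for n
  proof -
    from that have "1 \<le> n" "n \<le> N" by auto
    then show ?thesis
      by (induction n rule: dec_induct) (use energy scheme in auto)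
  qed
  have energy0: "discrete_energy \<Omega> \<alpha> \<beta> u \<phi> n = discrete_energy \<Omega> \<alpha> \<beta> u \<phi> 0"
    if "poisson_eq \<Omega> \<T> r \<alpha> \<beta> u \<phi> 0" "n \<in> {1..N}" for n
    using energy1[OF that(2)] energy[of 0] that assms(12) by simp
  show ?thesis
    by (intro conjI ballI impI) (rule mass0 energy1 energy0; assumption)+
qed

end
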